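(* Let $G=G(X,Y)$ be a bipartite graph with bipartition $(X,Y)$ and let $\sigma$ be an orientation of $G$. Then $Sp_S(G^\sigma)=i\,Sp(G)$ if and only if $\sigma$ is switching-equivalent to the elementary orientation of $G$ (the orientation in which every edge is directed from $X$ to $Y$).
   Context: All graphs are finite, simple and undirected. For a graph $G$ with vertices $v_1,\dots,v_n$, $Sp(G)$ is the spectrum (multiset of eigenvalues) of its adjacency matrix $A(G)$, and $i\,Sp(G)=\{i\lambda:\lambda\in Sp(G)\}$ as a multiset, where $i=\sqrt{-1}$. An orientation $\sigma$ of $G$ assigns a direction to each edge of $G$; the resulting oriented graph is $G^\sigma$. Its skew-adjacency matrix $S(G^\sigma)=[s_{jk}]$ is the $n\times n$ matrix with $s_{jk}=1$ and $s_{kj}=-1$ if there is an arc from $v_j$ to $v_k$, and $s_{jk}=s_{kj}=0$ if $v_j,v_k$ are not adjacent. The skew-spectrum $Sp_S(G^\sigma)$ is the spectrum (multiset of eigenvalues) of $S(G^\sigma)$. For a vertex subset $W$ of $G^\sigma$ with complement $\overline{W}=V(G)\setminus W$, switching with respect to $W$ means reversing the directions of all arcs between $W$ and $\overline{W}$. Two orientations of $G$ (or the corresponding oriented graphs) are switching-equivalent if one can be obtained from the other by a sequence of switchings. For a bipartite graph $G=G(X,Y)$, the elementary orientation assigns to each edge the direction from its endpoint in $X$ to its endpoint in $Y$. *)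

theory Defs
  imports
    "Graph_Theory.Pair_Digraph"
    "Jordan_Normal_Form.Char_Poly"
    Complex_Main
begin

text \<open>
  A finite simple undirected graph is a \<open>pair_graph\<close>, i.e. a finite loop-free digraph with
  symmetric arc set: the edge between \<open>u\<close> and \<open>v\<close> is the pair of arcs \<open>(u, v)\<close>, \<open>(v, u)\<close>.
  An oriented graph is a digraph containing exactly one of these two arcs for each edge.
\<close>

definition is_orientation :: "'a pair_pre_digraph \<Rightarrow> 'a pair_pre_digraph \<Rightarrow> bool" where
  "is_orientation G D \<longleftrightarrow>
     pverts D = pverts G \<and> parcs D \<subseteq> parcs G \<and>
     (\<forall>u v. (u, v) \<in> parcs G \<longrightarrow> ((u, v) \<in> parcs D \<longleftrightarrow> (v, u) \<notin> parcs D))"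

text \<open>The matrices are taken with respect to an enumeration \<open>vs\<close> of the vertices, and have complex
  entries because the skew-spectrum is purely imaginary.\<close>

definition adjacency_mat :: "'a list \<Rightarrow> 'a pair_pre_digraph \<Rightarrow> complex mat" where
  "adjacency_mat vs G = mat (length vs) (length vs)
     (\<lambda>(j, k). if (vs ! j, vs ! k) \<in> parcs G then 1 else 0)"

definition skew_adjacency_mat :: "'a list \<Rightarrow> 'a pair_pre_digraph \<Rightarrow> complex mat" where
  "skew_adjacency_mat vs D = mat (length vs) (length vs)
     (\<lambda>(j, k). if (vs ! j, vs ! k) \<in> parcs D then 1
               else if (vs ! k, vs ! j) \<in> parcs D then - 1
               else 0)"

text \<open>Eigenvalues counted with algebraic multiplicity.\<close>

definition eigenvalue_mset :: "complex mat \<Rightarrow> complex multiset" where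
  "eigenvalue_mset A = proots (char_poly A)"

definition Sp :: "'a list \<Rightarrow> 'a pair_pre_digraph \<Rightarrow> complex multiset" where
  "Sp vs G = eigenvalue_mset (adjacency_mat vs G)"

definition Sp_skew :: "'a list \<Rightarrow> 'a pair_pre_digraph \<Rightarrow> complex multiset" where
  "Sp_skew vs D = eigenvalue_mset (skew_adjacency_mat vs D)"

definition switch :: "'a set \<Rightarrow> 'a pair_pre_digraph \<Rightarrow> 'a pair_pre_digraph" where
  "switch W D = D\<lparr> parcs :=
     {(u, v). (u, v) \<in> parcs D \<and> (u \<in> W \<longleftrightarrow> v \<in> W)} \<union>
     {(v, u) | u v. (u, v) \<in> parcs D \<and> \<not> (u \<in> W \<longleftrightarrow> v \<in> W)} \<rparr>"

definition switching_equivalent :: "'a pair_pre_digraph \<Rightarrow> 'a pair_pre_digraph \<Rightarrow> bool" where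
  "switching_equivalent = (\<lambda>D D'. \<exists>W \<subseteq> pverts D. D' = switch W D)\<^sup>*\<^sup>*"

definition is_bipartition :: "'a pair_pre_digraph \<Rightarrow> 'a set \<Rightarrow> 'a set \<Rightarrow> bool" where
  "is_bipartition G X Y \<longleftrightarrow>
     X \<union> Y = pverts G \<and> X \<inter> Y = {} \<and>
     (\<forall>(u, v) \<in> parcs G. u \<in> X \<and> v \<in> Y \<or> u \<in> Y \<and> v \<in> X)"

definition elementary_orientation ::
    "'a pair_pre_digraph \<Rightarrow> 'a set \<Rightarrow> 'a set \<Rightarrow> 'a pair_pre_digraph" where
  "elementary_orientation G X Y = G\<lparr> parcs := {(u, v) \<in> parcs G. u \<in> X \<and> v \<in> Y} \<rparr>"

lemma is_orientation_elementary:
  assumes "pair_graph G" "is_bipartition G X Y"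
  shows "is_orientation G (elementary_orientation G X Y)"
proof -
  interpret pair_graph G by fact
  have sym: "(u, v) \<in> parcs G \<Longrightarrow> (v, u) \<in> parcs G" for u v
    using pair_sym_arcs by (metis symmetric_def symD with_proj_simps(3))
  have arc: "u \<in> X \<and> v \<in> Y \<and> u \<notin> Y \<and> v \<notin> X \<or> u \<in> Y \<and> v \<in> X \<and> u \<notin> X \<and> v \<notin> Y"
    if "(u, v) \<in> parcs G" for u v
    using assms(2) that unfolding is_bipartition_def by blast
  have mem: "(u, v) \<in> parcs (elementary_orientation G X Y) \<longleftrightarrow>
      (u, v) \<in> parcs G \<and> u \<in> X \<and> v \<in> Y" for u v
    by (simp add: elementary_orientation_def)
  have "parcs (elementary_orientation G X Y) \<subseteq> parcs G"
    by (rule subrelI) (simp add: mem)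
  moreover have "(u, v) \<in> parcs (elementary_orientation G X Y) \<longleftrightarrow>
      (v, u) \<notin> parcs (elementary_orientation G X Y)" if "(u, v) \<in> parcs G" for u v
    unfolding mem using that sym[OF that] arc[OF that] by argo
  moreover have "pverts (elementary_orientation G X Y) = pverts G"
    by (simp add: elementary_orientation_def)
  ultimately show ?thesis
    unfolding is_orientation_def by simp
qed

lemma is_orientation_switch:
  assumes "pair_graph G" "is_orientation G D"
  shows "is_orientation G (switch W D)"
proof -
  interpret pair_graph G by fact
  have sym: "(u, v) \<in> parcs G \<Longrightarrow> (v, u) \<in> parcs G" for u v
    using pair_sym_arcs by (metis symmetric_def symD with_proj_simps(3))
  have D: "pverts D = pverts G" "parcs D \<subseteq> parcs G"
    "\<And>u v. (u, v) \<in> parcs G \<Longrightarrow> (u, v) \<in> parcs D \<longleftrightarrow> (v, u) \<notin> parcs D"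
    using assms(2) unfolding is_orientation_def by blast+
  have mem: "(u, v) \<in> parcs (switch W D) \<longleftrightarrow>
      (if u \<in> W \<longleftrightarrow> v \<in> W then (u, v) \<in> parcs D else (v, u) \<in> parcs D)" for u v
    by (cases "u \<in> W"; cases "v \<in> W") (simp_all add: switch_def)
  have "parcs (switch W D) \<subseteq> parcs G"
  proof clarify
    fix u v assume "(u, v) \<in> parcs (switch W D)"
    then have "(u, v) \<in> parcs D \<or> (v, u) \<in> parcs D" unfolding mem by (simp split: if_splits)
    then show "(u, v) \<in> parcs G" using D(2) sym[of v u] by auto
  qed
  moreover have "(u, v) \<in> parcs (switch W D) \<longleftrightarrow> (v, u) \<notin> parcs (switch W D)"
    if "(u, v) \<in> parcs G" for u v
    unfolding mem using D(3)[OF that] by (cases "u \<in> W"; cases "v \<in> W") simp_all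
  moreover have "pverts (switch W D) = pverts G"
    using D(1) by (simp add: switch_def)
  ultimately show ?thesis
    unfolding is_orientation_def by simp
qed

end

theory Submission
  imports Defs "Jordan_Normal_Form.Schur_Decomposition"
begin

text \<open>
  Label an edge of \<open>G\<close> by \<open>1\<close> if \<open>\<sigma>\<close> directs it from \<open>X\<close> to \<open>Y\<close>, and by \<open>-1\<close> otherwise. These
  labels turn the adjacency matrix \<open>A\<close> into a real symmetric matrix \<open>B\<close> with entrywise modulus \<open>A\<close>.
  Conjugating by the diagonal matrix with entry \<open>1\<close> on \<open>X\<close> and \<open>\<i>\<close> on \<open>Y\<close> transforms \<open>\<i> B\<close> into the
  skew-adjacency matrix of \<open>\<sigma>\<close>, because its \<open>X\<close>-\<open>Y\<close> and \<open>Y\<close>-\<open>X\<close> blocks acquire opposite signs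
  (\<open>Sp_skew_conv_agreement\<close>). The spectral condition thus says that \<open>B\<close> and \<open>A\<close> are cospectral. On the
  other side, successive switchings compose to a single one (\<open>switching_equivalent_iff_switch\<close>), and
  switching at \<open>W\<close> produces the elementary orientation exactly if the edges labelled \<open>-1\<close> are those
  between \<open>W\<close> and its complement, that is, if \<open>B = E A E\<close> for a diagonal sign matrix \<open>E\<close>.

  What remains is a fact about a real symmetric matrix \<open>B\<close> with modulus \<open>A\<close>
  (\<open>cospectral_with_modulus_iff_balanced\<close>): they are cospectral iff \<open>B = E A E\<close> for some such \<open>E\<close>. If
  \<open>B = E A E\<close>, they are similar. Conversely, cospectral matrices have powers of equal trace
  (\<open>trace_pow_eq_power_sum\<close>). The diagonal entry of \<open>A^k\<close> at \<open>i\<close> adds up the weights of the closed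
  walks of length \<open>k\<close> from \<open>i\<close>, and that of \<open>B^k\<close> adds up the same weights multiplied by the signs of
  the walks. A single closed walk of negative sign would therefore make the trace of \<open>B^k\<close> strictly
  smaller. As \<open>B\<close> is symmetric, walks can be reversed, so any two walks with the same ends have the
  same sign. Fixing a root in each component and taking as \<open>E\<close> the sign of the walks from the root
  gives \<open>B = E A E\<close>.
\<close>

section \<open>Spectra and traces of powers\<close>

lemma eigenvalue_mset_similar:
  assumes "similar_mat A B"
  shows "eigenvalue_mset A = eigenvalue_mset B"
  unfolding eigenvalue_mset_def by (simp add: char_poly_similar[OF assms])

lemma eigenvalue_mset_upper_triangular:
  assumes "T \<in> carrier_mat n n" "upper_triangular T"
  shows "eigenvalue_mset T = mset (diag_mat T)"
proof -
  have "proots (\<Prod>a\<leftarrow>as. [:- a, 1:]) = mset as" for as :: "complex list"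
  proof (induction as)
    case (Cons a as)
    have "(\<Prod>a\<leftarrow>as. [:- a, 1:]) \<noteq> 0"
      by (auto simp: prod_list_zero_iff)
    then show ?case
      using Cons by (simp add: proots_mult del: mult_pCons_left)
  qed simp
  then show ?thesis
    unfolding eigenvalue_mset_def by (simp add: char_poly_upper_triangular[OF assms])
qed

text \<open>
  The spectrum of a triangular matrix can be read off its diagonal, and scalar multiples and powers
  act on that diagonal entrywise. Triangularisation thus reduces their effect on the spectrum of an
  arbitrary complex matrix to this case.
\<close>

lemma complex_mat_triangularizable:
  assumes "(A :: complex mat) \<in> carrier_mat n n"
  obtains T where "T \<in> carrier_mat n n" "upper_triangular T" "similar_mat A T"
  using char_poly_factorized[OF assms] schur_decomposition_exists[OF assms] by metis

lemma eigenvalue_mset_smult: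
  assumes "A \<in> carrier_mat n n"
  shows "eigenvalue_mset (c \<cdot>\<^sub>m A) = image_mset (\<lambda>x. c * x) (eigenvalue_mset A)"
proof -
  obtain T where T: "T \<in> carrier_mat n n" "upper_triangular T" "similar_mat A T"
    using complex_mat_triangularizable[OF assms] .
  have cT: "c \<cdot>\<^sub>m T \<in> carrier_mat n n" "upper_triangular (c \<cdot>\<^sub>m T)"
    using T(1,2) by (auto simp: upper_triangular_def)
  have "diag_mat (c \<cdot>\<^sub>m T) = map (\<lambda>x. c * x) (diag_mat T)"
    using T(1) by (auto simp: diag_mat_def)
  then show ?thesis
    using eigenvalue_mset_similar[OF T(3)] eigenvalue_mset_similar[OF similar_mat_smult[OF T(3)]]
      eigenvalue_mset_upper_triangular[OF T(1,2)] eigenvalue_mset_upper_triangular[OF cT]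
    by (simp add: mset_map)
qed

definition trace :: "'a :: comm_ring_1 mat \<Rightarrow> 'a" where
  "trace A = (\<Sum>i<dim_row A. A $$ (i, i))"

lemma index_mult_mat_sum:
  assumes "A \<in> carrier_mat n n" "B \<in> carrier_mat n n" "i < n" "j < n"
  shows "(A * B) $$ (i, j) = (\<Sum>l<n. A $$ (i, l) * B $$ (l, j))"
  using assms by (auto simp: scalar_prod_def atLeast0LessThan intro!: sum.cong)

lemma trace_mult_commute:
  assumes A: "A \<in> carrier_mat n n" and B: "B \<in> carrier_mat n n"
  shows "trace (A * B) = trace (B * A)"
proof -
  have "trace (A * B) = (\<Sum>i<n. \<Sum>l<n. A $$ (i, l) * B $$ (l, i))"
    using A B by (simp add: trace_def index_mult_mat_sum[OF A B] del: index_mult_mat(1))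
  also have "\<dots> = (\<Sum>l<n. \<Sum>i<n. B $$ (l, i) * A $$ (i, l))"
    by (subst sum.swap) (simp add: mult.commute)
  also have "\<dots> = trace (B * A)"
    using A B by (simp add: trace_def index_mult_mat_sum[OF B A] del: index_mult_mat(1))
  finally show ?thesis .
qed

lemma trace_pow_similar:
  assumes A: "A \<in> carrier_mat n n" and sim: "similar_mat A B"
  shows "trace (A ^\<^sub>m k) = trace (B ^\<^sub>m k)"
proof -
  obtain P Q where wit: "similar_mat_wit A B P Q"
    using sim unfolding similar_mat_def by blast
  note w = similar_mat_witD2[OF A wit]
  have Bk: "B ^\<^sub>m k \<in> carrier_mat n n"
    using w(5) by simp
  have "trace (A ^\<^sub>m k) = trace (P * (B ^\<^sub>m k * Q))"
    using similar_mat_wit_pow_id[OF wit, of k] assoc_mult_mat[OF w(6) Bk w(7)] by simp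
  also have "\<dots> = trace (B ^\<^sub>m k * Q * P)"
    using trace_mult_commute[OF w(6), of "B ^\<^sub>m k * Q"] Bk w(7) by simp
  also have "B ^\<^sub>m k * Q * P = B ^\<^sub>m k"
    using assoc_mult_mat[OF Bk w(7,6)] w(2) right_mult_one_mat[OF Bk] by simp
  finally show ?thesis .
qed

lemma upper_triangular_pow:
  fixes T :: "'a :: comm_ring_1 mat"
  assumes T: "T \<in> carrier_mat n n" and ut: "upper_triangular T"
  shows "(\<forall>i<n. \<forall>j<i. (T ^\<^sub>m k) $$ (i, j) = 0) \<and> (\<forall>i<n. (T ^\<^sub>m k) $$ (i, i) = (T $$ (i, i)) ^ k)"
proof (induction k)
  case 0
  then show ?case using T by simp
next
  case (Suc k)
  have Tk: "T ^\<^sub>m k \<in> carrier_mat n n" using T by simp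
  have z: "T $$ (i, j) = 0" if "i < n" "j < i" for i j
    using that T ut by (auto simp: upper_triangular_def)
  have "(T ^\<^sub>m Suc k) $$ (i, j) = 0" if ij: "i < n" "j < i" for i j
  proof -
    have "(T ^\<^sub>m k) $$ (i, l) * T $$ (l, j) = 0" if "l < n" for l
      using Suc.IH z[of l j] that ij by (cases "l < i") auto
    then show ?thesis
      using ij by (simp add: index_mult_mat_sum[OF Tk T] del: index_mult_mat(1))
  qed
  moreover have "(T ^\<^sub>m Suc k) $$ (i, i) = (T $$ (i, i)) ^ Suc k" if i: "i < n" for i
  proof -
    have "(T ^\<^sub>m Suc k) $$ (i, i) = (\<Sum>l<n. (T ^\<^sub>m k) $$ (i, l) * T $$ (l, i))"
      using i by (simp add: index_mult_mat_sum[OF Tk T] del: index_mult_mat(1))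
    also have "\<dots> = (\<Sum>l<n. if l = i then (T $$ (i, i)) ^ Suc k else 0)"
    proof (rule sum.cong)
      fix l assume "l \<in> {..<n}"
      then show "(T ^\<^sub>m k) $$ (i, l) * T $$ (l, i) = (if l = i then (T $$ (i, i)) ^ Suc k else 0)"
        using Suc.IH z[of l i] i by (cases l i rule: linorder_cases) (auto simp: mult.commute)
    qed simp
    also have "\<dots> = (T $$ (i, i)) ^ Suc k"
      using i by simp
    finally show ?thesis .
  qed
  ultimately show ?case by blast
qed

lemma trace_pow_eq_power_sum:
  assumes A: "A \<in> carrier_mat n n"
  shows "trace (A ^\<^sub>m k) = (\<Sum>x\<in>#eigenvalue_mset A. x ^ k)"
proof -
  obtain T where T: "T \<in> carrier_mat n n" "upper_triangular T" "similar_mat A T"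
    using complex_mat_triangularizable[OF A] .
  have "trace (A ^\<^sub>m k) = (\<Sum>i<n. (T $$ (i, i)) ^ k)"
    using T(1) trace_pow_similar[OF A T(3)] upper_triangular_pow[OF T(1,2)] by (simp add: trace_def)
  also have "\<dots> = (\<Sum>x\<in>#mset (diag_mat T). x ^ k)"
    using T(1) by (simp add: diag_mat_def sum_mset_sum_list comp_def interv_sum_list_conv_sum_set_nat
        atLeast0LessThan flip: mset_map)
  finally show ?thesis
    using eigenvalue_mset_similar[OF T(3)] eigenvalue_mset_upper_triangular[OF T(1,2)] by simp
qed

lemma similar_mat_diagonal_scaling:
  fixes A B :: "'a :: field mat"
  assumes A: "A \<in> carrier_mat n n" and B: "B \<in> carrier_mat n n"
    and d: "\<And>i. i < n \<Longrightarrow> d i \<noteq> 0"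
    and eq: "\<And>i j. i < n \<Longrightarrow> j < n \<Longrightarrow> B $$ (i, j) = d i * A $$ (i, j) / d j"
  shows "similar_mat B A"
proof (rule similar_matI[of _ _ "mat_diag n d" "mat_diag n (\<lambda>i. inverse (d i))" n])
  show "mat_diag n d * mat_diag n (\<lambda>i. inverse (d i)) = 1\<^sub>m n"
    "mat_diag n (\<lambda>i. inverse (d i)) * mat_diag n d = 1\<^sub>m n"
    unfolding mat_diag_diag by (rule eq_matI; use d in \<open>auto simp: mat_diag_def\<close>)+
  show "B = mat_diag n d * A * mat_diag n (\<lambda>i. inverse (d i))"
    using A B by (intro eq_matI)
      (auto simp: eq mat_diag_mult_left[OF A] mat_diag_mult_right[of _ n] divide_inverse)
qed (use A B in auto)

section \<open>Matrices cospectral with their modulus\<close>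

text \<open>
  Every walk contributes to the right-hand side the modulus of its contribution to the left-hand side;
  in the induction on the length this is the triangle inequality.
\<close>

lemma abs_pow_le_pow_abs:
  fixes B :: "real mat"
  assumes B: "B \<in> carrier_mat n n" and "i < n" "j < n"
  shows "\<bar>(B ^\<^sub>m k) $$ (i, j)\<bar> \<le> (map_mat abs B ^\<^sub>m k) $$ (i, j)"
  using assms(2,3)
proof (induction k arbitrary: j)
  case 0
  then show ?case using B by simp
next
  case (Suc k)
  let ?A = "map_mat abs B"
  have A: "?A \<in> carrier_mat n n" and Ak: "?A ^\<^sub>m k \<in> carrier_mat n n" and Bk: "B ^\<^sub>m k \<in> carrier_mat n n"
    using B by simp_all
  have "\<bar>(B ^\<^sub>m Suc k) $$ (i, j)\<bar> \<le> (\<Sum>l<n. \<bar>(B ^\<^sub>m k) $$ (i, l)\<bar> * \<bar>B $$ (l, j)\<bar>)"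
    using Suc.prems by (simp add: index_mult_mat_sum[OF Bk B] flip: abs_mult del: index_mult_mat(1))
  also have "\<dots> \<le> (\<Sum>l<n. (?A ^\<^sub>m k) $$ (i, l) * ?A $$ (l, j))"
    using Suc.IH[OF \<open>i < n\<close>] Suc.prems B by (intro sum_mono) (simp add: mult_right_mono)
  also have "\<dots> = (?A ^\<^sub>m Suc k) $$ (i, j)"
    using Suc.prems by (simp add: index_mult_mat_sum[OF Ak A] del: index_mult_mat(1))
  finally show ?case .
qed

text \<open>
  The double cover of the signed graph whose edges are the nonzero entries of the matrix: a walk from
  \<open>(i, 1)\<close> to \<open>(j, s)\<close> in the cover is a walk from \<open>i\<close> to \<open>j\<close> whose edge signs have product \<open>s\<close>.
  Reachability in the cover thus encodes the signs of walks. The second component ranges over all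
  reals, but from a start at \<open>1\<close> only \<open>1\<close> and \<open>-1\<close> are reachable.
\<close>

definition sign_cover :: "real mat \<Rightarrow> (nat \<times> real) rel" where
  "sign_cover B = {((i, s), (j, s * sgn (B $$ (i, j)))) | i j s.
     i < dim_row B \<and> j < dim_row B \<and> B $$ (i, j) \<noteq> 0}"

lemma sign_cover_scale:
  assumes "((i, s), (j, t)) \<in> (sign_cover B)\<^sup>*"
  shows "((i, c * s), (j, c * t)) \<in> (sign_cover B)\<^sup>*"
  using assms
proof (induction rule: rtrancl_induct2)
  case (step j t k u)
  have "((j, c * t), (k, c * u)) \<in> sign_cover B"
    using step.hyps(2) by (auto simp: sign_cover_def mult.assoc)
  with step.IH show ?case by (rule rtrancl_into_rtrancl)
qed simp

lemma sign_cover_sym: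
  assumes B: "B \<in> carrier_mat n n" and sym: "\<And>i j. i < n \<Longrightarrow> j < n \<Longrightarrow> B $$ (i, j) = B $$ (j, i)"
  shows "sym ((sign_cover B)\<^sup>*)"
proof (rule sym_rtrancl, rule symI)
  fix p q assume "(p, q) \<in> sign_cover B"
  then obtain i j s where pq: "p = (i, s)" "q = (j, s * sgn (B $$ (i, j)))" "i < n" "j < n"
    and nz: "B $$ (i, j) \<noteq> 0"
    using B by (auto simp: sign_cover_def)
  have "p = (i, s * sgn (B $$ (i, j)) * sgn (B $$ (j, i)))"
    using nz sym[OF pq(3,4)] by (simp add: pq(1) sgn_if)
  with pq nz show "(q, p) \<in> sign_cover B"
    unfolding sign_cover_def using B sym[OF pq(3,4)] by auto
qed

text \<open>
  In \<open>A^k + s B^k\<close>, where \<open>A\<close> is the modulus of \<open>B\<close>, the walks of sign \<open>-s\<close> cancel and those of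
  sign \<open>s\<close> count twice, so one walk of sign \<open>s\<close> is enough for a positive entry.
\<close>

lemma sign_cover_walk_pow:
  assumes B: "B \<in> carrier_mat n n" and i: "i < n"
    and walk: "((i, 1), (j, s)) \<in> (sign_cover B)\<^sup>*"
  shows "j < n \<and> (s = 1 \<or> s = -1) \<and>
    (\<exists>k. 0 < (map_mat abs B ^\<^sub>m k) $$ (i, j) + s * (B ^\<^sub>m k) $$ (i, j))"
  using walk
proof (induction rule: rtrancl_induct2)
  case refl
  have "0 < (map_mat abs B ^\<^sub>m 0) $$ (i, i) + 1 * (B ^\<^sub>m 0) $$ (i, i)"
    using B i by simp
  with i show ?case by blast
next
  case (step j s m u)
  let ?A = "map_mat abs B"
  define t where "t = sgn (B $$ (j, m))"
  have j: "j < n" and m: "m < n" and nz: "B $$ (j, m) \<noteq> 0" and u: "u = s * t"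
    using step.hyps(2) B by (auto simp: sign_cover_def t_def)
  have t: "t = 1 \<or> t = -1" and Bt: "B $$ (j, m) * t = \<bar>B $$ (j, m)\<bar>"
    using nz by (auto simp: t_def sgn_if)
  from step.IH obtain k where s: "s = 1 \<or> s = -1"
    and pos: "0 < (?A ^\<^sub>m k) $$ (i, j) + s * (B ^\<^sub>m k) $$ (i, j)" by blast
  have A: "?A \<in> carrier_mat n n" and Ak: "?A ^\<^sub>m k \<in> carrier_mat n n" and Bk: "B ^\<^sub>m k \<in> carrier_mat n n"
    using B by simp_all
  \<comment> \<open>The contribution of the walks that reach \<open>m\<close> through \<open>l\<close> in the last step: it is never negative,
    and positive for \<open>l = j\<close>.\<close>
  let ?f = "\<lambda>l. (?A ^\<^sub>m k) $$ (i, l) * ?A $$ (l, m) + u * ((B ^\<^sub>m k) $$ (i, l) * B $$ (l, m))"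
  have us: "\<bar>u\<bar> = 1" using s t u by auto
  have "0 \<le> ?f l" if "l < n" for l
  proof -
    have "\<bar>u * ((B ^\<^sub>m k) $$ (i, l) * B $$ (l, m))\<bar> \<le> (?A ^\<^sub>m k) $$ (i, l) * ?A $$ (l, m)"
      using abs_pow_le_pow_abs[OF B i that, of k] that m B us
      by (simp add: abs_mult mult_right_mono)
    then show ?thesis by linarith
  qed
  moreover have "?f j = ((?A ^\<^sub>m k) $$ (i, j) + s * (B ^\<^sub>m k) $$ (i, j)) * \<bar>B $$ (j, m)\<bar>"
    using j m B by (simp add: u flip: Bt) (simp add: algebra_simps Bt[symmetric] t_def sgn_if)
  then have "0 < ?f j" using pos nz by simp
  ultimately have "0 < (\<Sum>l<n. ?f l)"
    using j by (intro sum_pos2[of _ j]) auto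
  also have "(\<Sum>l<n. ?f l) = (?A ^\<^sub>m Suc k) $$ (i, m) + u * (B ^\<^sub>m Suc k) $$ (i, m)"
    using i m by (simp add: index_mult_mat_sum[OF Ak A] index_mult_mat_sum[OF Bk B] sum.distrib
        sum_distrib_left del: index_mult_mat(1))
  finally have "0 < (?A ^\<^sub>m Suc k) $$ (i, m) + u * (B ^\<^sub>m Suc k) $$ (i, m)" .
  moreover have "u = 1 \<or> u = -1" using s t u by auto
  ultimately show ?case using m by blast
qed

text \<open>
  Each diagonal entry of \<open>B^k\<close> is at most the corresponding entry for the modulus, so equal traces force
  equality in every entry, whereas a negative closed walk at \<open>i\<close> makes the inequality strict there.
\<close>

lemma no_negative_closed_walk:
  assumes B: "B \<in> carrier_mat n n"
    and tr: "\<And>k. trace (B ^\<^sub>m k) = trace (map_mat abs B ^\<^sub>m k)" and i: "i < n"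
  shows "((i, 1), (i, - 1)) \<notin> (sign_cover B)\<^sup>*"
proof
  assume "((i, 1), (i, - 1)) \<in> (sign_cover B)\<^sup>*"
  then obtain k where k: "0 < (map_mat abs B ^\<^sub>m k) $$ (i, i) + (-1) * (B ^\<^sub>m k) $$ (i, i)"
    using sign_cover_walk_pow[OF B i] by blast
  let ?f = "\<lambda>i. (map_mat abs B ^\<^sub>m k) $$ (i, i) - (B ^\<^sub>m k) $$ (i, i)"
  have "0 \<le> ?f j" if "j < n" for j
    using abs_pow_le_pow_abs[OF B that that, of k] by linarith
  then have "0 < (\<Sum>j<n. ?f j)"
    using k i by (intro sum_pos2[of _ i]) auto
  then show False
    using tr[of k] B by (simp add: trace_def sum_subtractf)
qed

text \<open>
  Choose the least vertex of each component as its root and let \<open>e v\<close> be the sign of a walk from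
  the root to \<open>v\<close>. Two walks of opposite signs would combine to a negative closed walk at the root,
  so \<open>e\<close> does not depend on the walk, and prolonging a walk to \<open>v\<close> by an edge from \<open>v\<close> to \<open>w\<close> shows
  that this edge has the sign \<open>e v * e w\<close>.
\<close>

lemma balanced_if_no_negative_closed_walk:
  assumes B: "B \<in> carrier_mat n n"
    and sym: "\<And>i j. i < n \<Longrightarrow> j < n \<Longrightarrow> B $$ (i, j) = B $$ (j, i)"
    and no_neg: "\<And>i. i < n \<Longrightarrow> ((i, 1), (i, - 1)) \<notin> (sign_cover B)\<^sup>*"
  obtains e :: "nat \<Rightarrow> real" where "\<And>i. e i = 1 \<or> e i = -1"
    "\<And>i j. i < n \<Longrightarrow> j < n \<Longrightarrow> B $$ (i, j) = e i * \<bar>B $$ (i, j)\<bar> * e j"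
proof -
  define R where "R = (sign_cover B)\<^sup>*"
  define conn where "conn r v \<longleftrightarrow> (\<exists>s. ((r, 1), (v, s)) \<in> R)" for r v
  define root where "root v = (LEAST r. conn r v)" for v
  define e :: "nat \<Rightarrow> real" where "e v = (if ((root v, 1), (v, 1)) \<in> R then 1 else -1)" for v
  have conn_refl: "conn v v" for v
    by (auto simp: conn_def R_def)
  have conn_root: "conn (root v) v" for v
    unfolding root_def by (rule LeastI[of "\<lambda>r. conn r v", OF conn_refl])
  have root_less: "root v < n" if "v < n" for v
    using Least_le[of "\<lambda>r. conn r v", OF conn_refl] that unfolding root_def by linarith
  have symR: "(q, p) \<in> R" if "(p, q) \<in> R" for p q
    using sign_cover_sym[OF B sym] that unfolding R_def by (blast dest: symD)
  have e_eq: "e v = s" if v: "v < n" and s: "((root v, 1), (v, s)) \<in> R" for v s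
  proof (cases "s = 1")
    case True
    then show ?thesis using s by (simp add: e_def)
  next
    case False
    then have s1: "s = -1"
      using sign_cover_walk_pow[OF B root_less[OF v]] s by (auto simp: R_def)
    have "((root v, 1), (v, 1)) \<notin> R"
    proof
      assume "((root v, 1), (v, 1)) \<in> R"
      \<comment> \<open>Go from the root to \<open>v\<close> with sign \<open>-1\<close> and return along the reverse of the positive walk.\<close>
      then have "((v, 1), (root v, 1)) \<in> R" by (rule symR)
      then have "((v, -1), (root v, -1)) \<in> R"
        using sign_cover_scale[of v 1 "root v" 1 B "-1"] by (simp add: R_def)
      then have "((root v, 1), (root v, -1)) \<in> R"
        using s s1 unfolding R_def by (auto intro: rtrancl_trans)
      then show False using no_neg[OF root_less[OF v]] by (simp add: R_def)
    qed
    then show ?thesis using s1 by (simp add: e_def)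
  qed
  have "B $$ (v, w) = e v * \<bar>B $$ (v, w)\<bar> * e w" if v: "v < n" and w: "w < n" for v w
  proof (cases "B $$ (v, w) = 0")
    case False
    have edge: "((v, s), (w, s * sgn (B $$ (v, w)))) \<in> R" for s
      unfolding R_def using v w False B by (intro r_into_rtrancl) (auto simp: sign_cover_def)
    have edge': "((w, s), (v, s * sgn (B $$ (v, w)))) \<in> R" for s
      unfolding R_def using v w False B sym[OF v w]
      by (intro r_into_rtrancl) (auto simp: sign_cover_def)
    have "conn r v = conn r w" for r
      unfolding conn_def using edge edge' unfolding R_def by (meson rtrancl_trans)
    then have root_eq: "root w = root v" by (simp add: root_def)
    obtain s where s: "((root v, 1), (v, s)) \<in> R"
      using conn_root[of v] by (auto simp: conn_def)
    then have "((root w, 1), (w, s * sgn (B $$ (v, w)))) \<in> R"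
      using edge[of s] unfolding root_eq R_def by (rule rtrancl_trans)
    then have "e w = s * sgn (B $$ (v, w))" using e_eq w by blast
    moreover have "e v = s" using e_eq v s by blast
    moreover have "s = 1 \<or> s = -1"
      using sign_cover_walk_pow[OF B root_less[OF v]] s by (auto simp: R_def)
    ultimately show ?thesis by (auto simp: sgn_if)
  qed simp
  moreover have "e i = 1 \<or> e i = -1" for i by (simp add: e_def)
  ultimately show ?thesis using that by blast
qed

theorem cospectral_with_modulus_iff_balanced:
  assumes B: "B \<in> carrier_mat n n"
    and sym: "\<And>i j. i < n \<Longrightarrow> j < n \<Longrightarrow> B $$ (i, j) = B $$ (j, i)"
  shows "eigenvalue_mset (map_mat of_real B) = eigenvalue_mset (map_mat of_real (map_mat abs B)) \<longleftrightarrow>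
    (\<exists>e :: nat \<Rightarrow> real. (\<forall>i. e i = 1 \<or> e i = -1) \<and>
      (\<forall>i<n. \<forall>j<n. B $$ (i, j) = e i * \<bar>B $$ (i, j)\<bar> * e j))"
    (is "?spec \<longleftrightarrow> ?bal")
proof
  assume spec: ?spec
  have A: "map_mat abs B \<in> carrier_mat n n" using B by simp
  have "complex_of_real (trace (M ^\<^sub>m k)) = trace (map_mat of_real M ^\<^sub>m k)"
    if "M \<in> carrier_mat n n" for M k
    using that by (simp add: trace_def flip: of_real_hom.mat_hom_pow[OF that])
  from this[OF B] this[OF A] have "trace (B ^\<^sub>m k) = trace (map_mat abs B ^\<^sub>m k)" for k
    using spec B trace_pow_eq_power_sum[of "map_mat of_real B" n k]
      trace_pow_eq_power_sum[of "map_mat of_real (map_mat abs B)" n k]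
    by (metis map_carrier_mat of_real_eq_iff)
  then show ?bal
    using balanced_if_no_negative_closed_walk[OF B sym no_negative_closed_walk[OF B]] by metis
next
  assume ?bal
  then obtain e :: "nat \<Rightarrow> real" where e: "\<And>i. e i = 1 \<or> e i = -1"
    and eq: "\<And>i j. i < n \<Longrightarrow> j < n \<Longrightarrow> B $$ (i, j) = e i * \<bar>B $$ (i, j)\<bar> * e j" by blast
  have inv: "e j = inverse (e j)" "e j \<noteq> 0" for j using e[of j] by auto
  have "similar_mat (map_mat complex_of_real B) (map_mat of_real (map_mat abs B))"
  proof (rule similar_mat_diagonal_scaling[of _ n _ "\<lambda>i. of_real (e i)"])
    fix i j assume ij: "i < n" "j < n"
    have "B $$ (i, j) = e i * \<bar>B $$ (i, j)\<bar> / e j"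
      using eq[OF ij] inv(1)[of j] by (simp add: divide_inverse)
    then have "complex_of_real (B $$ (i, j)) = of_real (e i * \<bar>B $$ (i, j)\<bar> / e j)"
      by (rule arg_cong)
    then show "map_mat complex_of_real B $$ (i, j) =
        of_real (e i) * map_mat of_real (map_mat abs B) $$ (i, j) / of_real (e j)"
      using ij B by simp
  qed (use B inv(2) in auto)
  then show ?spec by (rule eigenvalue_mset_similar)
qed

section \<open>Orientations of a bipartite graph as signings\<close>

text \<open>
  The signed adjacency matrix that compares \<open>D\<close> with the elementary orientation: for a bipartition with
  first part \<open>X\<close>, an edge \<open>(u, v)\<close> has the same direction in both iff \<open>(u, v) \<in> parcs D \<longleftrightarrow> u \<in> X\<close>. This
  form of the condition does not change when \<open>u\<close> and \<open>v\<close> are exchanged, hence the matrix is symmetric.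
\<close>

definition agreement_mat ::
    "'a list \<Rightarrow> 'a pair_pre_digraph \<Rightarrow> 'a set \<Rightarrow> 'a pair_pre_digraph \<Rightarrow> real mat" where
  "agreement_mat vs G X D = mat (length vs) (length vs)
     (\<lambda>(j, k). if (vs ! j, vs ! k) \<in> parcs G
               then if (vs ! j, vs ! k) \<in> parcs D \<longleftrightarrow> vs ! j \<in> X then 1 else - 1
               else 0)"

lemma pair_graph_sym:
  assumes "pair_graph G" "(u, v) \<in> parcs G"
  shows "(v, u) \<in> parcs G"
proof -
  interpret pair_graph G by fact
  show ?thesis
    using pair_sym_arcs assms(2) by (metis symmetric_def symD with_proj_simps(3))
qed

lemma is_bipartitionD:
  assumes "is_bipartition G X Y" "(u, v) \<in> parcs G"
  shows "u \<in> X \<longleftrightarrow> v \<notin> X" "u \<in> Y \<longleftrightarrow> u \<notin> X"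
  using assms unfolding is_bipartition_def by blast+

lemma is_orientationD:
  assumes "is_orientation G D"
  shows "pverts D = pverts G" "(u, v) \<in> parcs D \<Longrightarrow> (u, v) \<in> parcs G"
    "(u, v) \<in> parcs G \<Longrightarrow> (u, v) \<in> parcs D \<longleftrightarrow> (v, u) \<notin> parcs D"
  using assms unfolding is_orientation_def by blast+

lemma agreement_mat_sym:
  assumes "pair_graph G" "is_bipartition G X Y" "is_orientation G D"
    and "i < length vs" "j < length vs"
  shows "agreement_mat vs G X D $$ (i, j) = agreement_mat vs G X D $$ (j, i)"
  using assms(4,5) pair_graph_sym[OF assms(1), of "vs ! i" "vs ! j"]
    pair_graph_sym[OF assms(1), of "vs ! j" "vs ! i"]
    is_bipartitionD(1)[OF assms(2), of "vs ! i" "vs ! j"]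
    is_orientationD(3)[OF assms(3), of "vs ! i" "vs ! j"]
  by (auto simp: agreement_mat_def)

lemma Sp_conv_modulus:
  "Sp vs G = eigenvalue_mset (map_mat of_real (map_mat abs (agreement_mat vs G X D)))"
  unfolding Sp_def by (rule arg_cong[where f = eigenvalue_mset], rule eq_matI)
    (auto simp: adjacency_mat_def agreement_mat_def)

text \<open>
  Let \<open>c\<close> be \<open>1\<close> on \<open>X\<close> and \<open>\<i>\<close> on \<open>Y\<close>. Then \<open>c u * \<i> / c v\<close> is \<open>1\<close> for an edge from \<open>X\<close> to \<open>Y\<close> and \<open>-1\<close>
  for an edge from \<open>Y\<close> to \<open>X\<close>, so conjugation by \<open>c\<close> turns \<open>\<i>\<close> times the symmetric agreement matrix
  into the skew-symmetric matrix of \<open>D\<close>.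
\<close>

lemma Sp_skew_conv_agreement:
  assumes "pair_graph G" "is_bipartition G X Y" "is_orientation G D"
  shows "Sp_skew vs D =
    image_mset (\<lambda>x. \<i> * x) (eigenvalue_mset (map_mat of_real (agreement_mat vs G X D)))"
proof -
  let ?n = "length vs" and ?B = "map_mat complex_of_real (agreement_mat vs G X D)"
  have B: "?B \<in> carrier_mat ?n ?n" by (simp add: agreement_mat_def)
  have "similar_mat (skew_adjacency_mat vs D) (\<i> \<cdot>\<^sub>m ?B)"
  proof (rule similar_mat_diagonal_scaling[of _ ?n _ "\<lambda>j. if vs ! j \<in> X then 1 else \<i>"])
    fix i j assume ij: "i < ?n" "j < ?n"
    let ?u = "vs ! i" and ?v = "vs ! j"
    have "(?u, ?v) \<notin> parcs D \<and> (?v, ?u) \<notin> parcs D" if "(?u, ?v) \<notin> parcs G"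
      using that is_orientationD(2)[OF assms(3)] pair_graph_sym[OF assms(1)] by blast
    then show "skew_adjacency_mat vs D $$ (i, j) =
        (if ?u \<in> X then 1 else \<i>) * (\<i> \<cdot>\<^sub>m ?B) $$ (i, j) / (if ?v \<in> X then 1 else \<i>)"
      using ij is_bipartitionD(1)[OF assms(2), of ?u ?v] is_orientationD(3)[OF assms(3), of ?u ?v]
      by (auto simp: skew_adjacency_mat_def agreement_mat_def)
  qed (use B in \<open>auto simp: skew_adjacency_mat_def\<close>)
  then show ?thesis
    unfolding Sp_skew_def using eigenvalue_mset_similar eigenvalue_mset_smult[OF B] by metis
qed

section \<open>Switching\<close>

lemma pverts_switch [simp]: "pverts (switch W D) = pverts D"
  by (simp add: switch_def)

lemma parcs_switch_iff:
  "(u, v) \<in> parcs (switch W D) \<longleftrightarrow>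
    (if u \<in> W \<longleftrightarrow> v \<in> W then (u, v) \<in> parcs D else (v, u) \<in> parcs D)"
  by (cases "u \<in> W"; cases "v \<in> W") (simp_all add: switch_def)

lemma digraph_eqI:
  fixes D D' :: "'a pair_pre_digraph"
  assumes "pverts D = pverts D'" "\<And>u v. (u, v) \<in> parcs D \<longleftrightarrow> (u, v) \<in> parcs D'"
  shows "D = D'"
  using assms by (intro pair_pre_digraph.equality) auto

lemma switch_switch: "switch W (switch W' D) = switch ((W - W') \<union> (W' - W)) D"
  by (rule digraph_eqI) (auto simp: parcs_switch_iff)

lemma switching_equivalent_iff_switch:
  "switching_equivalent D D' \<longleftrightarrow> (\<exists>W\<subseteq>pverts D. D' = switch W D)"
proof
  assume "switching_equivalent D D'"
  then have "(\<lambda>D D'. \<exists>W\<subseteq>pverts D. D' = switch W D)\<^sup>*\<^sup>* D D'"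
    by (simp add: switching_equivalent_def)
  then show "\<exists>W\<subseteq>pverts D. D' = switch W D"
  proof (induction rule: rtranclp_induct)
    case base
    have "D = switch {} D" by (rule digraph_eqI) (auto simp: parcs_switch_iff)
    then show ?case by blast
  next
    case (step E F)
    then obtain W W' where "W' \<subseteq> pverts D" "E = switch W' D" "W \<subseteq> pverts E" "F = switch W E" by blast
    then have "F = switch ((W - W') \<union> (W' - W)) D" "(W - W') \<union> (W' - W) \<subseteq> pverts D"
      by (auto simp: switch_switch)
    then show ?case by blast
  qed
next
  assume "\<exists>W\<subseteq>pverts D. D' = switch W D"
  then show "switching_equivalent D D'"
    unfolding switching_equivalent_def by (rule r_into_rtranclp)
qed

text \<open>
  Switching at \<open>W\<close> has to reverse exactly the edges directed from \<open>Y\<close> to \<open>X\<close>.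
\<close>

lemma switch_eq_elementary_iff:
  assumes G: "pair_graph G" and bip: "is_bipartition G X Y" and ori: "is_orientation G D"
  shows "elementary_orientation G X Y = switch W D \<longleftrightarrow>
    (\<forall>(u, v) \<in> parcs G. ((u, v) \<in> parcs D \<longleftrightarrow> u \<in> X) \<longleftrightarrow> (u \<in> W \<longleftrightarrow> v \<in> W))"
    (is "?E = _ \<longleftrightarrow> ?sep")
proof -
  have E: "(u, v) \<in> parcs ?E \<longleftrightarrow> (u, v) \<in> parcs G \<and> u \<in> X" for u v
    using is_bipartitionD[OF bip, of u v] is_bipartitionD[OF bip pair_graph_sym[OF G], of u v]
    by (auto simp: elementary_orientation_def)
  have "?E = switch W D \<longleftrightarrow> (\<forall>u v. (u, v) \<in> parcs ?E \<longleftrightarrow> (u, v) \<in> parcs (switch W D))"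
  proof
    have "pverts ?E = pverts (switch W D)"
      using is_orientationD(1)[OF ori] by (simp add: elementary_orientation_def)
    moreover assume "\<forall>u v. (u, v) \<in> parcs ?E \<longleftrightarrow> (u, v) \<in> parcs (switch W D)"
    ultimately show "?E = switch W D"
      using digraph_eqI[of ?E "switch W D"] by metis
  next
    assume "?E = switch W D"
    then show "\<forall>u v. (u, v) \<in> parcs ?E \<longleftrightarrow> (u, v) \<in> parcs (switch W D)" by metis
  qed
  also have "\<dots> \<longleftrightarrow> (\<forall>(u, v) \<in> parcs G. (u, v) \<in> parcs ?E \<longleftrightarrow> (u, v) \<in> parcs (switch W D))"
    using is_orientationD(2)[OF is_orientation_switch[OF G ori]] E by blast
  also have "\<dots> \<longleftrightarrow> ?sep"
    using is_orientationD(3)[OF ori] by (auto simp: E parcs_switch_iff split: if_splits)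
  finally show ?thesis .
qed

theorem theorem2p2:
  fixes G \<sigma> :: "'a pair_pre_digraph" and X Y :: "'a set" and vs :: "'a list"
  assumes "pair_graph G"
    and "distinct vs" and "set vs = pverts G"
    and "is_bipartition G X Y"
    and "is_orientation G \<sigma>"
  shows "Sp_skew vs \<sigma> = image_mset (\<lambda>x. \<i> * x) (Sp vs G) \<longleftrightarrow>
         switching_equivalent \<sigma> (elementary_orientation G X Y)"
proof -
  interpret pair_graph G by fact
  let ?n = "length vs" and ?B = "agreement_mat vs G X \<sigma>"
  have B: "?B \<in> carrier_mat ?n ?n" by (simp add: agreement_mat_def)
  have "inj (image_mset (\<lambda>x. \<i> * x))" by (rule multiset.inj_map) (simp add: inj_def)
  then have "Sp_skew vs \<sigma> = image_mset (\<lambda>x. \<i> * x) (Sp vs G) \<longleftrightarrow>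
      eigenvalue_mset (map_mat of_real ?B) = eigenvalue_mset (map_mat of_real (map_mat abs ?B))"
    unfolding Sp_skew_conv_agreement[OF assms(1,4,5)] Sp_conv_modulus[of vs G X \<sigma>]
    by (simp only: inj_eq)
  also have "\<dots> \<longleftrightarrow> (\<exists>e :: nat \<Rightarrow> real. (\<forall>i. e i = 1 \<or> e i = -1) \<and>
      (\<forall>i<?n. \<forall>j<?n. ?B $$ (i, j) = e i * \<bar>?B $$ (i, j)\<bar> * e j))"
    using cospectral_with_modulus_iff_balanced[OF B agreement_mat_sym[OF assms(1,4,5)]] .
  also have "\<dots> \<longleftrightarrow> (\<exists>W\<subseteq>pverts G. \<forall>(u, v) \<in> parcs G.
      ((u, v) \<in> parcs \<sigma> \<longleftrightarrow> u \<in> X) \<longleftrightarrow> (u \<in> W \<longleftrightarrow> v \<in> W))"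
    (is "(\<exists>e. ?sgn e \<and> ?bal e) \<longleftrightarrow> (\<exists>W\<subseteq>pverts G. ?sep W)")
  proof
    assume "\<exists>e. ?sgn e \<and> ?bal e"
    then obtain e :: "nat \<Rightarrow> real" where e: "?sgn e" and bal: "?bal e" by blast
    define W where "W = {vs ! i | i. i < ?n \<and> e i = 1}"
    have W: "vs ! i \<in> W \<longleftrightarrow> e i = 1" if "i < ?n" for i
      using that assms(2) by (auto simp: W_def nth_eq_iff_index_eq)
    have "?sep W"
    proof clarify
      fix u v assume uv: "(u, v) \<in> parcs G"
      then obtain i j where ij: "i < ?n" "j < ?n" "u = vs ! i" "v = vs ! j"
        using assms(3) in_arcsD1 in_arcsD2 by (metis in_set_conv_nth)
      have val: "?B $$ (i, j) = (if (u, v) \<in> parcs \<sigma> \<longleftrightarrow> u \<in> X then 1 else -1)"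
        using uv ij by (simp add: agreement_mat_def)
      have "?B $$ (i, j) = e i * \<bar>?B $$ (i, j)\<bar> * e j" using bal ij by blast
      then have "(if (u, v) \<in> parcs \<sigma> \<longleftrightarrow> u \<in> X then 1 else -1) = e i * e j"
        unfolding val by (simp split: if_splits)
      then show "((u, v) \<in> parcs \<sigma> \<longleftrightarrow> u \<in> X) \<longleftrightarrow> (u \<in> W \<longleftrightarrow> v \<in> W)"
        using W[OF ij(1)] W[OF ij(2)] e[rule_format, of i] e[rule_format, of j]
        unfolding ij(3,4) by (auto split: if_splits)
    qed
    moreover have "W \<subseteq> pverts G" unfolding assms(3)[symmetric] by (auto simp: W_def)
    ultimately show "\<exists>W\<subseteq>pverts G. ?sep W" by (intro exI[of _ W] conjI)
  next
    assume "\<exists>W\<subseteq>pverts G. ?sep W"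
    then obtain W where sep: "?sep W" by blast
    define e :: "nat \<Rightarrow> real" where "e i = (if vs ! i \<in> W then 1 else -1)" for i
    have "?bal e"
    proof (intro allI impI)
      fix i j assume ij: "i < ?n" "j < ?n"
      show "?B $$ (i, j) = e i * \<bar>?B $$ (i, j)\<bar> * e j"
        using sep[rule_format, of "(vs ! i, vs ! j)"] ij by (auto simp: agreement_mat_def e_def)
    qed
    moreover have "?sgn e" by (simp add: e_def)
    ultimately show "\<exists>e. ?sgn e \<and> ?bal e" by (intro exI[of _ e] conjI)
  qed
  also have "\<dots> \<longleftrightarrow> switching_equivalent \<sigma> (elementary_orientation G X Y)"
    unfolding switching_equivalent_iff_switch switch_eq_elementary_iff[OF assms(1,4,5)]
      is_orientationD(1)[OF assms(5)] ..
  finally show ?thesis .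
qed

end
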